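(* Let $G$ be a connected graph of order $n$ with distances $d_{rt}=d_G(v_r,v_t)$, and let $\mathcal{D}^S_r=\sum_{t=1,\,t\ne r}^n(2d_{rt}-1)$ for $r=1,\dots,n$. Then $$E_{\mathcal{D}^S}(G)\ge2\sqrt{\frac{\sum_{r=1}^n(\mathcal{D}^S_r)^2}{n}},$$ with equality if and only if $\mathcal{D}^S_1=\cdots=\mathcal{D}^S_n$ and $\mathcal{D}^S(G)$ has exactly one negative eigenvalue.
   Context: The distance Seidel matrix of a connected graph $G$ is $\mathcal{D}^S(G)=J-I-2\mathcal{D}(G)$, where $\mathcal{D}(G)=(d_{rt})$ is the distance matrix and $J$ the all-ones matrix. The distance Seidel energy is $E_{\mathcal{D}^S}(G)=\sum_{r=1}^n|\partial_r^S|$, the sum of the absolute values of the eigenvalues of $\mathcal{D}^S(G)$.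
   Formalization: The equality characterization is stated only for n ≥ 2: for the one-vertex graph both sides of the inequality are 0, so equality holds, but the matrix has no negative eigenvalue; the inequality itself is stated for all n. *)

theory Defs
  imports
    "Graph_Theory.Digraph_Component"
    "Graph_Theory.Shortest_Path"
    "Jordan_Normal_Form.Char_Poly"
begin

text \<open>
  Graphs are those of Graph_Theory's locale \<open>graph\<close>, that is, finite, loopless, symmetric digraphs
  without parallel arcs. The distance is the least cost of a walk for the weight constantly 1; it
  is finite for vertices of a connected graph, so that \<^const>\<open>real_of_ereal\<close> loses nothing there.
\<close>

definition graph_dist :: "('a, 'b) pre_digraph \<Rightarrow> 'a \<Rightarrow> 'a \<Rightarrow> real" where
  "graph_dist G u w = real_of_ereal (wf_digraph.\<mu> G (\<lambda>_. 1) u w)"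

text \<open>
  Below, \<open>v\<close> enumerates the vertices of \<open>G\<close> as \<open>v 0, \<dots>, v (n - 1)\<close> with \<open>n = card (verts G)\<close>.
\<close>

definition distance_matrix :: "('a, 'b) pre_digraph \<Rightarrow> (nat \<Rightarrow> 'a) \<Rightarrow> real mat" where
  "distance_matrix G v =
     mat (card (verts G)) (card (verts G)) (\<lambda>(r, t). graph_dist G (v r) (v t))"

definition distance_seidel_matrix :: "('a, 'b) pre_digraph \<Rightarrow> (nat \<Rightarrow> 'a) \<Rightarrow> real mat" where
  "distance_seidel_matrix G v =
     mat (card (verts G)) (card (verts G)) (\<lambda>_. 1) - 1\<^sub>m (card (verts G))
       - 2 \<cdot>\<^sub>m distance_matrix G v"

text \<open>
  The eigenvalues of a real matrix, with algebraic multiplicity. Only real eigenvalues are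
  collected; the distance Seidel matrix is symmetric, so all of its eigenvalues are real.
\<close>

definition eigenvalues_mset :: "real mat \<Rightarrow> real multiset" where
  "eigenvalues_mset A = proots (char_poly A)"

definition distance_seidel_energy :: "('a, 'b) pre_digraph \<Rightarrow> (nat \<Rightarrow> 'a) \<Rightarrow> real" where
  "distance_seidel_energy G v = (\<Sum>x\<in>#eigenvalues_mset (distance_seidel_matrix G v). \<bar>x\<bar>)"

definition distance_seidel_degree :: "('a, 'b) pre_digraph \<Rightarrow> (nat \<Rightarrow> 'a) \<Rightarrow> nat \<Rightarrow> real" where
  "distance_seidel_degree G v r =
     (\<Sum>t \<in> {..<card (verts G)} - {r}. 2 * graph_dist G (v r) (v t) - 1)"

end

(*
  Write -S for the nonnegative matrix with entries 2 d(r,t) - 1 off the diagonal. The trace of S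
  vanishes, so every eigenvalue of S is at most E/2 in absolute value; since the vector of the
  D_r is -S applied to the all-ones vector, expanding in an orthonormal eigenbasis gives
  sum D_r^2 <= (E/2)^2 n. In the case of equality the all-ones vector involves only eigenvalues
  E/2 and -E/2; the latter occurs as 1^T S 1 < 0, and it then exhausts the negative half of the
  energy. If E/2 occurred as well, S would have rank two and a vanishing off-diagonal entry for
  n >= 3; otherwise the all-ones vector is an eigenvector.
*)

theory Submission
  imports Defs
begin

section \<open>Diagonalization of real symmetric matrices\<close>

text \<open>The complexified matrix has an eigenvector by the fundamental theorem of algebra. Its
  real and imaginary parts do not both vanish, and a nonzero one is normalized.\<close>

lemma symmetric_real_eigenvector:
  fixes A :: "real mat"
  assumes A: "A \<in> carrier_mat n n" and sym: "A\<^sup>T = A" and n: "0 < n"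
  obtains v e where "v \<in> carrier_vec n" "v \<bullet> v = 1" "A *\<^sub>v v = e \<cdot>\<^sub>v v"
proof -
  let ?C = "map_mat complex_of_real A"
  have C: "?C \<in> carrier_mat n n" using A by simp
  have "degree (char_poly ?C) = n" using degree_monic_char_poly[OF C] by simp
  with n have "\<not> constant (poly (char_poly ?C))" by (simp add: constant_degree)
  then obtain z where "poly (char_poly ?C) z = 0"
    using fundamental_theorem_of_algebra by blast
  then have "eigenvalue ?C z" using eigenvalue_root_char_poly[OF C] by simp
  then obtain w where w: "w \<in> carrier_vec n" "w \<noteq> 0\<^sub>v n" "?C *\<^sub>v w = z \<cdot>\<^sub>v w"
    using C unfolding eigenvalue_def eigenvector_def by auto
  define x y where "x = (\<lambda>i. Re (w $ i))" and "y = (\<lambda>i. Im (w $ i))"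
  define a where "a = (\<lambda>i j. A $$ (i, j))"
  have asym: "a i j = a j i" if "i < n" "j < n" for i j
    using arg_cong[OF sym, of "\<lambda>M. M $$ (i, j)"] A that unfolding a_def by simp
  have ew: "(\<Sum>j<n. complex_of_real (a i j) * w $ j) = z * w $ i" if "i < n" for i
    using arg_cong[OF w(3), of "\<lambda>u. u $ i"] A w(1) that
    by (simp add: scalar_prod_def a_def atLeast0LessThan)
  have ax: "(\<Sum>j<n. a i j * x j) = Re z * x i - Im z * y i" if "i < n" for i
    using arg_cong[OF ew[OF that], of Re] by (simp add: x_def y_def)
  have ay: "(\<Sum>j<n. a i j * y j) = Re z * y i + Im z * x i" if "i < n" for i
    using arg_cong[OF ew[OF that], of Im] by (simp add: x_def y_def)
  \<comment> \<open>The bilinear form of \<open>A\<close> at \<open>y\<close> and \<open>x\<close>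
    is evaluated in both orders; the difference of the two values is \<open>Im z\<close> times the
    squared norm of \<open>w\<close>.\<close>
  have "(\<Sum>i<n. y i * (\<Sum>j<n. a i j * x j)) = (\<Sum>i<n. \<Sum>j<n. y i * a i j * x j)"
    by (simp add: sum_distrib_left mult.assoc)
  also have "\<dots> = (\<Sum>j<n. \<Sum>i<n. y i * a i j * x j)" by (rule sum.swap)
  also have "\<dots> = (\<Sum>i<n. x i * (\<Sum>j<n. a i j * y j))"
    by (auto simp: sum_distrib_left mult.assoc intro!: sum.cong) (simp add: asym mult_ac)
  \<comment> \<open>symmetry forces \<open>z\<close> to be real, so the real and imaginary parts of \<open>w\<close> are eigenvectors\<close>
  finally have "(\<Sum>i<n. y i * (Re z * x i - Im z * y i)) = (\<Sum>i<n. x i * (Re z * y i + Im z * x i))"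
    by (simp add: ax ay)
  then have "Im z * (\<Sum>i<n. (x i)\<^sup>2 + (y i)\<^sup>2) = 0"
    by (simp add: algebra_simps sum.distrib sum_subtractf power2_eq_square flip: sum_distrib_left)
  moreover have "(\<Sum>i<n. (x i)\<^sup>2 + (y i)\<^sup>2) \<noteq> 0"
  proof
    assume "(\<Sum>i<n. (x i)\<^sup>2 + (y i)\<^sup>2) = 0"
    then have "\<forall>i<n. (x i)\<^sup>2 + (y i)\<^sup>2 = 0"
      by (subst (asm) sum_nonneg_eq_0_iff) auto
    then have "w = 0\<^sub>v n"
      using w(1) by (intro eq_vecI) (auto simp: x_def y_def sum_power2_eq_zero_iff complex_eq_iff)
    with w(2) show False by simp
  qed
  ultimately have im: "Im z = 0" by simp
  have main: "\<exists>v. v \<in> carrier_vec n \<and> v \<bullet> v = 1 \<and> A *\<^sub>v v = Re z \<cdot>\<^sub>v v"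
    if u: "\<And>i. i < n \<Longrightarrow> (\<Sum>j<n. a i j * u j) = Re z * u i" and k: "k < n" "u k \<noteq> 0" for u k
  proof -
    define s where "s = sqrt (\<Sum>i<n. (u i)\<^sup>2)"
    have "(\<Sum>i<n. (u i)\<^sup>2) > 0" using k by (intro sum_pos2[of _ k]) auto
    then have s: "s > 0" "s\<^sup>2 = (\<Sum>i<n. (u i)\<^sup>2)" by (auto simp: s_def)
    let ?v = "Matrix.vec n (\<lambda>i. u i / s)"
    have "?v \<bullet> ?v = (\<Sum>i<n. (u i)\<^sup>2) / s\<^sup>2"
      by (simp add: scalar_prod_def atLeast0LessThan power2_eq_square sum_divide_distrib)
    then have "?v \<bullet> ?v = 1" using s(1) by (simp flip: s(2))
    moreover have "A *\<^sub>v ?v = Re z \<cdot>\<^sub>v ?v"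
    proof (rule eq_vecI)
      fix i assume "i < dim_vec (Re z \<cdot>\<^sub>v ?v)"
      then have i: "i < n" by simp
      have "(A *\<^sub>v ?v) $ i = (\<Sum>j<n. a i j * u j) / s"
        using A i by (simp add: scalar_prod_def atLeast0LessThan a_def sum_divide_distrib)
      then show "(A *\<^sub>v ?v) $ i = (Re z \<cdot>\<^sub>v ?v) $ i" using u i by simp
    qed (use A in simp)
    ultimately show ?thesis by (intro exI[of _ ?v]) auto
  qed
  obtain k where k: "k < n" "w $ k \<noteq> 0"
    using w(1,2) by (metis carrier_vecD eq_vecI index_zero_vec)
  then have "x k \<noteq> 0 \<or> y k \<noteq> 0" by (auto simp: x_def y_def complex_eq_iff)
  then show ?thesis
    using main[of x k] main[of y k] ax ay im k that by auto
qed

text \<open>The reflection along \<open>v - e_0\<close> exchanges these two unit vectors. Being a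
  symmetric involution, it is its own inverse and transpose when it is used for conjugation.\<close>

lemma householder_reflection:
  fixes v :: "real vec"
  assumes v: "v \<in> carrier_vec n" and unit: "v \<bullet> v = 1" and n: "0 < n"
  obtains H where "H \<in> carrier_mat n n" "H\<^sup>T = H" "H * H = 1\<^sub>m n" "H *\<^sub>v unit_vec n 0 = v"
proof -
  define u where "u = (\<lambda>i. v $ i - (if i = 0 then 1 else 0))"
  \<comment> \<open>\<open>2 / (u \<bullet> u)\<close>; if \<open>v\<close> is already the unit vector then \<open>u = 0\<close>, the division gives 0 and \<open>H = 1\<close>\<close>
  define c where "c = 1 / (1 - v $ 0)"
  let ?H = "Matrix.mat n n (\<lambda>(i, j). (if i = j then 1 else 0) - c * u i * u j)"
  have vv: "(\<Sum>i<n. (v $ i)\<^sup>2) = 1"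
    using v unit by (simp add: scalar_prod_def atLeast0LessThan power2_eq_square)
  have "(u i)\<^sup>2 = (v $ i)\<^sup>2 + (if i = 0 then 1 - 2 * v $ 0 else 0)" for i
    by (simp add: u_def power2_eq_square algebra_simps)
  then have uu: "(\<Sum>i<n. (u i)\<^sup>2) = 2 * (1 - v $ 0)"
    using n vv by (simp add: sum.distrib)
  have u0: "u i = 0" if "v $ 0 = 1" "i < n" for i
  proof -
    have "(\<Sum>i<n. (u i)\<^sup>2) = 0" using uu that by simp
    then show ?thesis using that by (subst (asm) sum_nonneg_eq_0_iff) auto
  qed
  have "?H * ?H = 1\<^sub>m n"
  proof (rule eq_matI)
    fix i j assume "i < dim_row (1\<^sub>m n :: real mat)" "j < dim_col (1\<^sub>m n :: real mat)"
    then have i: "i < n" and j: "j < n" by auto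
    have "(?H * ?H) $$ (i, j) = (\<Sum>k<n. ((if i = k then 1 else 0) - c * u i * u k)
        * ((if k = j then 1 else 0) - c * u k * u j))"
      using i j by (simp add: scalar_prod_def atLeast0LessThan)
    also have "\<dots> = (\<Sum>k<n. (if k = i then (if k = j then 1 else 0) - c * u k * u j else 0)
        - (if k = j then c * u i * u k else 0) + c * c * u i * u j * (u k)\<^sup>2)"
      by (intro sum.cong) (auto simp: algebra_simps power2_eq_square)
    also have "\<dots> = (if i = j then 1 else 0) - 2 * c * u i * u j + c * c * u i * u j * (\<Sum>k<n. (u k)\<^sup>2)"
      using i j by (simp add: sum.distrib sum_subtractf flip: sum_distrib_left)
    \<comment> \<open>The last two terms cancel because \<open>c\<close> times the squared norm of
      \<open>u\<close> is 2; if \<open>v $ 0 = 1\<close>, all \<open>u i\<close> vanish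
      instead.\<close>
    also have "\<dots> = (if i = j then 1 else 0)"
    proof (cases "v $ 0 = 1")
      case False
      then have "c * (2 * (1 - v $ 0)) = 2" by (simp add: c_def field_simps)
      then have "c * (2 * (1 - v $ 0)) * (c * u i * u j) = 2 * (c * u i * u j)" by simp
      moreover have "c * (2 * (1 - v $ 0)) * (c * u i * u j) = c * c * u i * u j * (2 * (1 - v $ 0))"
        by (simp only: mult_ac)
      ultimately have "c * c * u i * u j * (2 * (1 - v $ 0)) = 2 * (c * u i * u j)" by simp
      then show ?thesis unfolding uu by simp
    qed (use u0 i j in simp)
    finally show "(?H * ?H) $$ (i, j) = 1\<^sub>m n $$ (i, j)" using i j by simp
  qed auto
  moreover have "?H *\<^sub>v unit_vec n 0 = v"
  proof (rule eq_vecI)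
    fix i assume "i < dim_vec v"
    then have i: "i < n" using v by simp
    have "(?H *\<^sub>v unit_vec n 0) $ i = (if i = 0 then 1 else 0) - c * u i * u 0"
      using i n by simp
    also have "\<dots> = v $ i"
      using u0[of i] i by (cases "v $ 0 = 1") (auto simp: c_def u_def field_simps)
    finally show "(?H *\<^sub>v unit_vec n 0) $ i = v $ i" .
  qed (use v in simp)
  moreover have "?H\<^sup>T = ?H" by (rule eq_matI) auto
  ultimately show ?thesis by (intro that[of ?H]) auto
qed

lemma mult_four_block_diag:
  fixes A1 A2 D1 D2 :: "'a :: comm_ring_1 mat"
  assumes A: "A1 \<in> carrier_mat k k" "A2 \<in> carrier_mat k k"
    and D: "D1 \<in> carrier_mat n n" "D2 \<in> carrier_mat n n"
  shows "four_block_mat A1 (0\<^sub>m k n) (0\<^sub>m n k) D1 * four_block_mat A2 (0\<^sub>m k n) (0\<^sub>m n k) D2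
    = four_block_mat (A1 * A2) (0\<^sub>m k n) (0\<^sub>m n k) (D1 * D2)"
  using mult_four_block_mat[OF A(1) zero_carrier_mat zero_carrier_mat D(1) A(2) zero_carrier_mat
      zero_carrier_mat D(2)] assms
  by simp

text \<open>Induction on the order: conjugation by a reflection turns an eigenvector into the first
  coordinate vector, which splits off a 1 by 1 block and leaves a smaller symmetric matrix.\<close>

lemma spectral_theorem_real_symmetric:
  fixes A :: "real mat"
  assumes "A \<in> carrier_mat n n" and "A\<^sup>T = A"
  obtains Q d where "Q \<in> carrier_mat n n" "Q\<^sup>T * Q = 1\<^sub>m n" "A = Q * mat_diag n d * Q\<^sup>T"
  using assms
proof (induction n arbitrary: A thesis)
  case 0
  show ?case
    by (rule "0.prems"(1)[of "1\<^sub>m 0" "\<lambda>_. 0"]) (use "0.prems" in \<open>auto intro!: eq_matI\<close>)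
next
  case (Suc n)
  note A = Suc.prems(2) and sym = Suc.prems(3)
  obtain v e where v: "v \<in> carrier_vec (Suc n)" "v \<bullet> v = 1" and ev: "A *\<^sub>v v = e \<cdot>\<^sub>v v"
    using symmetric_real_eigenvector[OF A sym] by auto
  obtain H where H: "H \<in> carrier_mat (Suc n) (Suc n)" "H\<^sup>T = H" "H * H = 1\<^sub>m (Suc n)"
    and Hv: "H *\<^sub>v unit_vec (Suc n) 0 = v"
    using householder_reflection[OF v] by auto
  let ?e = "unit_vec (Suc n) 0 :: real vec"
  define B where "B = H * A * H"
  have B: "B \<in> carrier_mat (Suc n) (Suc n)" using H(1) A by (simp add: B_def)
  have Bsym: "B\<^sup>T = B"
    using H A sym by (simp add: B_def transpose_mult[of _ "Suc n" "Suc n" _ "Suc n"] assoc_mult_mat[of _ "Suc n" "Suc n" _ "Suc n" _ "Suc n"])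
  have AB: "A = H * B * H"
  proof -
    have "H * B * H = (H * H) * A * (H * H)"
      using H(1) A by (simp add: B_def assoc_mult_mat[of _ "Suc n" "Suc n" _ "Suc n" _ "Suc n"])
    then show ?thesis using H A by simp
  qed
  have "B *\<^sub>v ?e = H *\<^sub>v (A *\<^sub>v (H *\<^sub>v ?e))"
    using H(1) A by (simp add: B_def assoc_mult_mat_vec[of _ "Suc n" "Suc n" _ "Suc n"])
  also have "\<dots> = e \<cdot>\<^sub>v (H *\<^sub>v (H *\<^sub>v ?e))"
    using H(1) v(1) by (simp add: Hv ev mult_mat_vec)
  also have "H *\<^sub>v (H *\<^sub>v ?e) = ?e"
    using H by (simp flip: assoc_mult_mat_vec[of _ "Suc n" "Suc n" _ "Suc n"])
  finally have Be: "B *\<^sub>v ?e = e \<cdot>\<^sub>v ?e" .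
  \<comment> \<open>The first column is \<open>e\<close> times a unit vector; by symmetry
    (\<open>Bij\<close>) so is the first row, which makes \<open>B\<close> block diagonal.\<close>
  have col0: "B $$ (i, 0) = (if i = 0 then e else 0)" if "i < Suc n" for i
    using arg_cong[OF Be, of "\<lambda>u. u $ i"] B that by simp
  have Bij: "B $$ (i, j) = B $$ (j, i)" if "i < Suc n" "j < Suc n" for i j
    using arg_cong[OF Bsym, of "\<lambda>M. M $$ (i, j)"] B that by simp
  define A' where "A' = Matrix.mat n n (\<lambda>(i, j). B $$ (Suc i, Suc j))"
  let ?E = "Matrix.mat 1 1 (\<lambda>_. e)"
  have A': "A' \<in> carrier_mat n n" by (simp add: A'_def)
  have A'sym: "A'\<^sup>T = A'" by (rule eq_matI) (auto simp: A'_def Bij)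
  obtain Q d where Q: "Q \<in> carrier_mat n n" "Q\<^sup>T * Q = 1\<^sub>m n" "A' = Q * mat_diag n d * Q\<^sup>T"
    by (rule Suc.IH[OF _ A' A'sym])
  \<comment> \<open>\<open>P\<close> extends the diagonalizing matrix of the smaller block by 1;
    \<open>H * P\<close> then diagonalizes \<open>A\<close>, with \<open>e\<close> prepended to the
    eigenvalues.\<close>
  define P where "P = four_block_mat (1\<^sub>m 1) (0\<^sub>m 1 n) (0\<^sub>m n 1) Q"
  have P: "P \<in> carrier_mat (Suc n) (Suc n)" 
    using four_block_carrier_mat[OF one_carrier_mat[of 1] Q(1)] by (simp add: P_def)
  have Pt: "P\<^sup>T = four_block_mat (1\<^sub>m 1) (0\<^sub>m 1 n) (0\<^sub>m n 1) Q\<^sup>T"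
    unfolding P_def using Q(1) by (subst transpose_four_block_mat) auto
  have PP: "P\<^sup>T * P = 1\<^sub>m (Suc n)"
    unfolding Pt unfolding P_def using Q(1,2) by (subst mult_four_block_diag) simp_all
  let ?D = "mat_diag (Suc n) (case_nat e d)"
  have D: "?D = four_block_mat ?E (0\<^sub>m 1 n) (0\<^sub>m n 1) (mat_diag n d)"
    by (rule eq_matI) (auto simp: mat_diag_def split: nat.splits)
  have "P * ?D = four_block_mat ?E (0\<^sub>m 1 n) (0\<^sub>m n 1) (Q * mat_diag n d)"
    unfolding D P_def using Q(1) by (subst mult_four_block_diag) simp_all
  then have "P * ?D * P\<^sup>T = four_block_mat ?E (0\<^sub>m 1 n) (0\<^sub>m n 1) A'"
    unfolding Pt Q(3) using Q(1) by (simp add: mult_four_block_diag[of _ "Suc 0" _ _ n])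
  also have "\<dots> = B"
  proof (rule eq_matI)
    fix i j assume "i < dim_row B" "j < dim_col B"
    then show "four_block_mat ?E (0\<^sub>m 1 n) (0\<^sub>m n 1) A' $$ (i, j) = B $$ (i, j)"
      using B by (cases i; cases j) (simp_all add: A'_def col0 Bij[of 0])
  qed (use B in \<open>simp_all add: A'_def\<close>)
  finally have B_eq: "B = P * ?D * P\<^sup>T" ..
  have HPt: "(H * P)\<^sup>T = P\<^sup>T * H" using H P by (simp add: transpose_mult)
  have reassoc: "H * (P * D * P\<^sup>T) * H = H * P * D * (P\<^sup>T * H)"
    if "D \<in> carrier_mat (Suc n) (Suc n)" for D
    using H(1) P that by (simp add: assoc_mult_mat[of _ "Suc n" "Suc n" _ "Suc n" _ "Suc n"])
  show ?case
  proof (rule Suc.prems(1))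
    show "H * P \<in> carrier_mat (Suc n) (Suc n)" using H P by simp
    have "(H * P)\<^sup>T * (H * P) = P\<^sup>T * (H * H) * P"
      unfolding HPt using H(1) P by (simp add: assoc_mult_mat[of _ "Suc n" "Suc n" _ "Suc n" _ "Suc n"])
    then show "(H * P)\<^sup>T * (H * P) = 1\<^sub>m (Suc n)" using H PP P by simp
    show "A = H * P * ?D * (H * P)\<^sup>T"
      by (subst AB) (simp add: HPt B_eq reassoc)
  qed
qed

text \<open>Similar matrices share the characteristic polynomial, and that of a diagonal matrix is
  the product of its linear factors.\<close>

lemma eigenvalues_mset_orthogonal_diagonalization:
  assumes Q: "Q \<in> carrier_mat n n" "Q\<^sup>T * Q = 1\<^sub>m n" and A: "A = Q * mat_diag n d * Q\<^sup>T"
  shows "eigenvalues_mset A = image_mset d (mset_set {..<n})"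
proof -
  have QQ: "Q * Q\<^sup>T = 1\<^sub>m n"
    using mat_mult_left_right_inverse[OF _ Q(1) Q(2)] Q(1) by simp
  have "similar_mat A (mat_diag n d)"
    by (rule similar_matI[of _ _ Q "Q\<^sup>T" n]) (use Q QQ A in auto)
  then have "char_poly A = char_poly (mat_diag n d)" by (rule char_poly_similar)
  also have "\<dots> = (\<Prod>a\<leftarrow>diag_mat (mat_diag n d). [:- a, 1:])"
    by (rule char_poly_upper_triangular[of _ n]) (auto simp: mat_diag_def)
  also have "diag_mat (mat_diag n d) = map d [0..<n]"
    by (auto simp: diag_mat_def mat_diag_def)
  finally have "char_poly A = (\<Prod>i<n. [:- d i, 1:])"
    using prod.distinct_set_conv_list[of "[0..<n]" "\<lambda>i. [:- d i, 1:]"]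
    by (simp add: o_def atLeast0LessThan)
  moreover have "proots (\<Prod>i\<in>I. [:- d i, 1:]) = image_mset d (mset_set I)" if "finite I" for I
    using that by induction (auto simp: proots_mult simp del: mult_pCons_left)
  ultimately show ?thesis by (simp add: eigenvalues_mset_def)
qed

text \<open>Coordinate form of the spectral theorem, reducing what follows to finite sums. The
  relation for rows comes from that for columns, since a left inverse of a square matrix is a right
  inverse.\<close>

lemma symmetric_matrix_eigenbasis:
  fixes A :: "real mat"
  assumes A: "A \<in> carrier_mat n n" and "A\<^sup>T = A"
  obtains d q where
    "eigenvalues_mset A = image_mset d (mset_set {..<n})"
    "\<And>i j. i < n \<Longrightarrow> j < n \<Longrightarrow> (\<Sum>k<n. q k i * q k j) = (if i = j then 1 else 0)"
    "\<And>i j. i < n \<Longrightarrow> j < n \<Longrightarrow> (\<Sum>k<n. q i k * q j k) = (if i = j then 1 else 0)"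
    "\<And>i j. i < n \<Longrightarrow> j < n \<Longrightarrow> A $$ (i, j) = (\<Sum>k<n. d k * q i k * q j k)"
proof -
  obtain Q d where Q: "Q \<in> carrier_mat n n" "Q\<^sup>T * Q = 1\<^sub>m n" and D: "A = Q * mat_diag n d * Q\<^sup>T"
    using spectral_theorem_real_symmetric[OF assms] .
  have QQ: "Q * Q\<^sup>T = 1\<^sub>m n"
    using mat_mult_left_right_inverse[OF _ Q(1) Q(2)] Q(1) by simp
  show ?thesis
  proof (rule that[of d "\<lambda>i k. Q $$ (i, k)"])
    show "eigenvalues_mset A = image_mset d (mset_set {..<n})"
      by (rule eigenvalues_mset_orthogonal_diagonalization[OF Q D])
    fix i j assume ij: "i < n" "j < n"
    show "(\<Sum>k<n. Q $$ (k, i) * Q $$ (k, j)) = (if i = j then 1 else 0)"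
      using arg_cong[OF Q(2), of "\<lambda>M. M $$ (i, j)"] Q(1) ij by (simp add: scalar_prod_def atLeast0LessThan)
    show "(\<Sum>k<n. Q $$ (i, k) * Q $$ (j, k)) = (if i = j then 1 else 0)"
      using arg_cong[OF QQ, of "\<lambda>M. M $$ (i, j)"] Q(1) ij by (simp add: scalar_prod_def atLeast0LessThan)
    have "Q * mat_diag n d = Matrix.mat n n (\<lambda>(i, j). Q $$ (i, j) * d j)"
      using mat_diag_mult_right[OF Q(1)] .
    then show "A $$ (i, j) = (\<Sum>k<n. d k * Q $$ (i, k) * Q $$ (j, k))"
      unfolding D using Q(1) ij by (simp add: scalar_prod_def atLeast0LessThan mult_ac)
  qed
qed

section \<open>Distances in graphs\<close>

text \<open>The least cost is attained by a path. Its cost is its number of arcs, which is positive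
  as the ends differ.\<close>

lemma (in fin_digraph) graph_dist_ge_1:
  assumes "u \<rightarrow>\<^sup>* w" "u \<noteq> w"
  shows "1 \<le> graph_dist G u w"
proof -
  obtain p where p: "apath u p w" "\<mu> (\<lambda>_. 1) u w = awalk_cost (\<lambda>_. 1) p"
    using min_cost_awalk[OF assms(1), of "\<lambda>_. 1"] by auto
  have "p \<noteq> []" using p(1) assms(2) by (auto simp: apath_def awalk_def)
  then have "1 \<le> awalk_cost (\<lambda>_. 1) p"
    by (cases p) (auto simp: awalk_cost_def sum_list_triv)
  then show ?thesis by (simp add: graph_dist_def p(2))
qed

lemma (in fin_digraph) graph_dist_self:
  assumes "u \<in> verts G"
  shows "graph_dist G u u = 0"
proof -
  have "u \<rightarrow>\<^sup>* u" using assms by simp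
  then obtain p where p: "apath u p u" "\<mu> (\<lambda>_. 1) u u = awalk_cost (\<lambda>_. 1) p"
    using min_cost_awalk[of u u "\<lambda>_. 1"] by auto
  have "p = []" using apath_nonempty_ends[OF p(1)] by blast
  then show ?thesis by (simp add: graph_dist_def p(2))
qed

text \<open>Reversing a walk arc by arc preserves its length, so the infima over the two directions
  bound each other.\<close>

lemma (in graph) graph_dist_sym: "graph_dist G u w = graph_dist G w u"
proof -
  have "\<exists>q. awalk w q u \<and> length q = length p" if "awalk u p w" for u p w
    using that
  proof (induction p arbitrary: u)
    case Nil
    then show ?case by (intro exI[of _ "[]"]) (auto simp: awalk_Nil_iff)
  next
    case (Cons e p)
    then have e: "e \<in> arcs G" "tail G e = u" and "awalk (head G e) p w"
      by (auto simp: awalk_Cons_iff)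
    with Cons.IH obtain q where q: "awalk w q (head G e)" "length q = length p" by blast
    have "(u, head G e) \<in> arcs_ends G" using e by (auto simp: arcs_ends_conv)
    then have "(head G e, u) \<in> arcs_ends G"
      using sym_arcs by (auto simp: symmetric_def sym_def)
    then obtain e' where "e' \<in> arcs G" "tail G e' = head G e" "head G e' = u"
      by (auto simp: arcs_ends_conv)
    then have "awalk (head G e) [e'] u" by (auto simp: awalk_simps)
    with q show ?case by (intro exI[of _ "q @ [e']"]) auto
  qed
  note reverse = this
  have "\<mu> (\<lambda>_. 1) u w \<le> \<mu> (\<lambda>_. 1) w u" for u w
    unfolding \<mu>_def
  proof (rule INF_mono)
    fix p assume "p \<in> {p. awalk w p u}"
    then obtain q where "awalk u q w" "length q = length p" using reverse by blast
    then show "\<exists>q\<in>{p. awalk u p w}. ereal (awalk_cost (\<lambda>_. 1) q) \<le> ereal (awalk_cost (\<lambda>_. 1) p)"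
      by (intro bexI[of _ q]) (auto simp: awalk_cost_def sum_list_triv)
  qed
  then show ?thesis unfolding graph_dist_def by (metis antisym)
qed

section \<open>Symmetric matrices with zero diagonal and negative off-diagonal entries\<close>

text \<open>Isolates the matrix facts from the graph: \<open>q i k\<close> is the
  \<open>i\<close>-th entry of the \<open>k\<close>-th eigenvector, with eigenvalue
  \<open>d k\<close>.\<close>

locale hollow_spectral_decomposition =
  fixes n :: nat and a q :: "nat \<Rightarrow> nat \<Rightarrow> real" and d :: "nat \<Rightarrow> real"
  assumes columns: "\<And>i j. i < n \<Longrightarrow> j < n \<Longrightarrow> (\<Sum>k<n. q k i * q k j) = (if i = j then 1 else 0)"
    and rows: "\<And>i j. i < n \<Longrightarrow> j < n \<Longrightarrow> (\<Sum>k<n. q i k * q j k) = (if i = j then 1 else 0)"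
    and decomposition: "\<And>i j. i < n \<Longrightarrow> j < n \<Longrightarrow> a i j = (\<Sum>k<n. d k * q i k * q j k)"
    and hollow: "\<And>i. i < n \<Longrightarrow> a i i = 0"
    and off_diagonal_neg: "\<And>i j. i < n \<Longrightarrow> j < n \<Longrightarrow> i \<noteq> j \<Longrightarrow> a i j < 0"
begin

section \<open>The all-ones vector and the row sums in the eigenbasis\<close>

abbreviation "energy \<equiv> (\<Sum>k<n. \<bar>d k\<bar>)"

text \<open>For the distance Seidel matrix this is the distance Seidel degree, as the diagonal
  contributes 0.\<close>

definition "neg_row_sum i = (\<Sum>j<n. - a i j)"

text \<open>The coefficient of the all-ones vector along the \<open>k\<close>-th
  eigenvector.\<close>

definition "coord k = (\<Sum>i<n. q i k)"

lemma coefficient: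
  assumes "k < n"
  shows "(\<Sum>i<n. (\<Sum>l<n. f l * q i l) * q i k) = f k"
proof -
  have "(\<Sum>i<n. (\<Sum>l<n. f l * q i l) * q i k) = (\<Sum>i<n. \<Sum>l<n. f l * (q i l * q i k))"
    by (simp add: sum_distrib_right mult.assoc)
  also have "\<dots> = (\<Sum>l<n. f l * (\<Sum>i<n. q i l * q i k))"
    by (subst sum.swap) (simp add: sum_distrib_left)
  also have "\<dots> = (\<Sum>l<n. if l = k then f l else 0)"
    using assms by (intro sum.cong) (auto simp: columns)
  also have "\<dots> = f k" using assms by simp
  finally show ?thesis .
qed

lemma parseval: "(\<Sum>i<n. (\<Sum>k<n. f k * q i k)\<^sup>2) = (\<Sum>k<n. (f k)\<^sup>2)"
proof -
  \<comment> \<open>One factor of the square stays a sum, so that \<open>coefficient\<close> applies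
    after swapping.\<close>
  have "(\<Sum>i<n. (\<Sum>k<n. f k * q i k)\<^sup>2) = (\<Sum>i<n. \<Sum>k<n. f k * ((\<Sum>l<n. f l * q i l) * q i k))"
    by (simp add: power2_eq_square sum_distrib_left mult_ac)
  also have "\<dots> = (\<Sum>k<n. f k * (\<Sum>i<n. (\<Sum>l<n. f l * q i l) * q i k))"
    by (subst sum.swap) (simp add: sum_distrib_left)
  also have "\<dots> = (\<Sum>k<n. (f k)\<^sup>2)" by (simp add: coefficient power2_eq_square)
  finally show ?thesis .
qed

lemma ones_expansion:
  assumes "i < n"
  shows "(\<Sum>k<n. coord k * q i k) = 1"
proof -
  have "(\<Sum>k<n. coord k * q i k) = (\<Sum>k<n. \<Sum>j<n. q j k * q i k)"
    by (simp add: coord_def sum_distrib_right)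
  also have "\<dots> = (\<Sum>j<n. if j = i then 1 else 0)"
    using assms by (subst sum.swap) (simp add: rows)
  finally show ?thesis using assms by simp
qed

lemma sum_coord_squares: "(\<Sum>k<n. (coord k)\<^sup>2) = real n"
  using parseval[of coord] by (simp add: ones_expansion)

text \<open>The negated matrix applied to the all-ones vector scales its \<open>k\<close>-th
  coordinate by \<open>- d k\<close>.\<close>

lemma neg_row_sum_expansion:
  assumes "i < n"
  shows "neg_row_sum i = (\<Sum>k<n. (- d k * coord k) * q i k)"
proof -
  have "neg_row_sum i = - (\<Sum>j<n. \<Sum>k<n. d k * q i k * q j k)"
    using assms by (simp add: neg_row_sum_def sum_negf decomposition)
  also have "\<dots> = - (\<Sum>k<n. \<Sum>j<n. d k * q i k * q j k)"
    by (subst sum.swap) simp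
  also have "\<dots> = (\<Sum>k<n. (- d k * coord k) * q i k)"
    by (simp add: coord_def sum_negf sum_distrib_left sum_distrib_right mult_ac)
  finally show ?thesis .
qed

lemma sum_neg_row_sum_squares: "(\<Sum>i<n. (neg_row_sum i)\<^sup>2) = (\<Sum>k<n. (d k)\<^sup>2 * (coord k)\<^sup>2)"
  using parseval[of "\<lambda>k. - d k * coord k"] by (simp add: neg_row_sum_expansion power_mult_distrib)

text \<open>Both sides are the quadratic form of the negated matrix at the all-ones vector; its
  positivity later yields a negative eigenvalue with \<open>coord k\<close> nonzero.\<close>

lemma sum_neg_row_sum: "(\<Sum>i<n. neg_row_sum i) = (\<Sum>k<n. - d k * (coord k)\<^sup>2)"
proof -
  have "(\<Sum>i<n. neg_row_sum i) = (\<Sum>k<n. \<Sum>i<n. (- d k * coord k) * q i k)"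
    by (subst sum.swap) (simp add: neg_row_sum_expansion)
  then show ?thesis by (simp only: coord_def power2_eq_square mult.assoc flip: sum_distrib_left)
qed

section \<open>Trace zero and the energy bound\<close>

lemma trace_zero: "(\<Sum>k<n. d k) = 0"
proof -
  have "(\<Sum>k<n. d k) = (\<Sum>k<n. d k * (\<Sum>i<n. q i k * q i k))" by (simp add: columns)
  also have "\<dots> = (\<Sum>i<n. \<Sum>k<n. d k * q i k * q i k)"
    by (subst sum.swap) (simp add: sum_distrib_left mult.assoc)
  also have "\<dots> = (\<Sum>i<n. a i i)" by (simp add: decomposition)
  finally show ?thesis by (simp add: hollow)
qed

text \<open>The absolute value of \<open>x\<close> is \<open>2 * max 0 (- x) + x\<close>, and the
  linear terms add up to the trace, which is 0.\<close>

lemma half_energy_neg: "energy / 2 = (\<Sum>k<n. max 0 (- d k))"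
proof -
  have "energy = (\<Sum>k<n. 2 * max 0 (- d k) + d k)" by (intro sum.cong) auto
  then show ?thesis by (simp add: sum.distrib trace_zero flip: sum_distrib_left)
qed

lemma half_energy_pos: "energy / 2 = (\<Sum>k<n. max 0 (d k))"
proof -
  have "energy = (\<Sum>k<n. 2 * max 0 (d k) - d k)" by (intro sum.cong) auto
  then show ?thesis by (simp add: sum_subtractf trace_zero flip: sum_distrib_left)
qed

lemma abs_eigenvalue_le:
  assumes "k < n"
  shows "\<bar>d k\<bar> \<le> energy / 2"
proof -
  have "max 0 (- d k) \<le> energy / 2"
    unfolding half_energy_neg using assms by (intro member_le_sum) auto
  moreover have "max 0 (d k) \<le> energy / 2"
    unfolding half_energy_pos using assms by (intro member_le_sum) auto
  ultimately show ?thesis by linarith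
qed

text \<open>The negative parts sum to half the energy, and \<open>d m\<close> alone already uses all
  of it.\<close>

lemma nonneg_of_extreme_neg:
  assumes "m < n" "d m = - (energy / 2)" "k < n" "k \<noteq> m"
  shows "0 \<le> d k"
proof -
  have "max 0 (- d m) = energy / 2" unfolding assms(2) by (simp add: sum_nonneg)
  then have "(\<Sum>k\<in>{..<n} - {m}. max 0 (- d k)) = 0"
    using half_energy_neg assms(1) by (simp add: sum.remove[of _ m])
  then have "max 0 (- d k) = 0"
    using assms(3,4) by (subst (asm) sum_nonneg_eq_0_iff) auto
  then show ?thesis by simp
qed

lemma nonpos_of_extreme_pos:
  assumes "m < n" "d m = energy / 2" "k < n" "k \<noteq> m"
  shows "d k \<le> 0"
proof -
  have "max 0 (d m) = energy / 2" unfolding assms(2) by (simp add: sum_nonneg)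
  then have "(\<Sum>k\<in>{..<n} - {m}. max 0 (d k)) = 0"
    using half_energy_pos assms(1) by (simp add: sum.remove[of _ m])
  then have "max 0 (d k) = 0"
    using assms(3,4) by (subst (asm) sum_nonneg_eq_0_iff) auto
  then show ?thesis by simp
qed

text \<open>The left side weights each \<open>(d k)\<^sup>2\<close> by
  \<open>(coord k)\<^sup>2\<close>, and these weights sum to \<open>n\<close>.\<close>

lemma sum_neg_row_sum_squares_le: "(\<Sum>i<n. (neg_row_sum i)\<^sup>2) \<le> (energy / 2)\<^sup>2 * real n"
proof -
  have "(d k)\<^sup>2 \<le> (energy / 2)\<^sup>2" if "k < n" for k
    using abs_eigenvalue_le[OF that] by (metis abs_ge_zero power2_abs power_mono)
  then have "(\<Sum>k<n. (d k)\<^sup>2 * (coord k)\<^sup>2) \<le> (\<Sum>k<n. (energy / 2)\<^sup>2 * (coord k)\<^sup>2)"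
    by (intro sum_mono mult_right_mono) auto
  then show ?thesis
    by (simp add: sum_neg_row_sum_squares sum_coord_squares flip: sum_distrib_left)
qed

lemma neg_row_sum_pos:
  assumes "2 \<le> n" "i < n"
  shows "0 < neg_row_sum i"
proof -
  define j where "j = (if i = 0 then 1 else 0 :: nat)"
  have j: "j < n" "j \<noteq> i" using assms by (auto simp: j_def)
  show ?thesis
    unfolding neg_row_sum_def
  proof (rule sum_pos2[of _ j])
    show "0 < - a i j" using off_diagonal_neg[of i j] j assms by simp
    show "0 \<le> - a i l" if "l \<in> {..<n}" for l
      using off_diagonal_neg[of i l] hollow[of i] that assms by (cases "l = i") auto
  qed (use j in auto)
qed

lemma energy_lower_bound: "2 * sqrt ((\<Sum>i<n. (neg_row_sum i)\<^sup>2) / real n) \<le> energy"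
\<comment> \<open>For \<open>n = 0\<close> both sides are 0, division by zero giving 0.\<close>
proof (cases "n = 0")
  case False
  then have "(\<Sum>i<n. (neg_row_sum i)\<^sup>2) / real n \<le> (energy / 2)\<^sup>2"
    using sum_neg_row_sum_squares_le by (simp add: field_simps)
  then have "sqrt ((\<Sum>i<n. (neg_row_sum i)\<^sup>2) / real n) \<le> energy / 2"
    by (intro real_le_lsqrt) (simp_all add: sum_nonneg)
  then show ?thesis by simp
qed simp

section \<open>The case of equality\<close>

text \<open>With constant row sums the all-ones vector is an eigenvector for \<open>- s\<close>.
  This is then the sole negative eigenvalue, so half the energy is \<open>s\<close>.\<close>

lemma energy_eq_if:
  assumes n: "2 \<le> n"
    and const: "\<And>i j. i < n \<Longrightarrow> j < n \<Longrightarrow> neg_row_sum i = neg_row_sum j"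
    and card: "card {k. k < n \<and> d k < 0} = 1"
  shows "energy = 2 * sqrt ((\<Sum>i<n. (neg_row_sum i)\<^sup>2) / real n)"
proof -
  define s where "s = neg_row_sum 0"
  have s: "neg_row_sum i = s" if "i < n" for i using const[of i 0] that n by (simp add: s_def)
  have s_pos: "0 < s" using neg_row_sum_pos[of 0] n by (simp add: s_def)
  \<comment> \<open>Both sides are the \<open>k\<close>-th coefficient of the constant vector of row
    sums.\<close>
  have eig: "- d k * coord k = s * coord k" if "k < n" for k
  proof -
    have "- d k * coord k = (\<Sum>i<n. neg_row_sum i * q i k)"
      using coefficient[OF that, of "\<lambda>k. - d k * coord k"] by (simp add: neg_row_sum_expansion)
    also have "\<dots> = (\<Sum>i<n. s * q i k)" by (intro sum.cong) (auto simp: s)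
    finally show ?thesis by (simp add: coord_def sum_distrib_left)
  qed
  have "\<exists>k<n. coord k \<noteq> 0"
  proof (rule ccontr)
    assume "\<not> (\<exists>k<n. coord k \<noteq> 0)"
    then have "(\<Sum>k<n. (coord k)\<^sup>2) = 0" by (intro sum.neutral) auto
    then show False using n by (simp add: sum_coord_squares)
  qed
  then obtain k where k: "k < n" "coord k \<noteq> 0" by blast
  then have dk: "d k = - s" using eig[OF k(1)] unfolding mult_right_cancel[OF k(2)] by linarith
  obtain m where m: "{k. k < n \<and> d k < 0} = {m}" using card_1_singletonE[OF card] .
  have "k \<in> {k. k < n \<and> d k < 0}" using k dk s_pos by simp
  then have "k = m" unfolding m by simp
  have "energy / 2 = (\<Sum>l<n. if l = k then s else 0)"
    unfolding half_energy_neg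
  proof (rule sum.cong)
    fix l assume "l \<in> {..<n}"
    then show "max 0 (- d l) = (if l = k then s else 0)"
      using m dk s_pos \<open>k = m\<close> by (cases "d l < 0") auto
  qed simp
  then have "energy = 2 * s" using k by simp
  moreover have "(\<Sum>i<n. (neg_row_sum i)\<^sup>2) = (\<Sum>i<n. s\<^sup>2)" by (intro sum.cong) (auto simp: s)
  ultimately show ?thesis using n s_pos by simp
qed

text \<open>
  With a second extreme eigenvalue, \<open>a i j = P (x i x j - y i y j)\<close> for two vectors \<open>x\<close>, \<open>y\<close>
  whose entries agree up to sign because the diagonal vanishes. Of any three indices, two have the
  same relative sign and hence a vanishing entry \<open>a i j\<close>.
\<close>

lemma extreme_pair_imp_le_2:
  assumes j: "j < n" "d j = energy / 2" and m: "m < n" "d m = - (energy / 2)" and "j \<noteq> m"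
  shows "n \<le> 2"
proof (rule ccontr)
  assume "\<not> n \<le> 2"
  then have n: "2 < n" by simp
  let ?P = "energy / 2"
  \<comment> \<open>Each extreme eigenvalue exhausts its own sign, so the others are both
    nonnegative and nonpositive.\<close>
  have zero: "d k = 0" if "k < n" "k \<noteq> j" "k \<noteq> m" for k
    using nonneg_of_extreme_neg[OF m that(1,3)] nonpos_of_extreme_pos[OF j that(1,2)] by simp
  have a_eq: "a r t = ?P * (q r j * q t j - q r m * q t m)" if "r < n" "t < n" for r t
  proof -
    have "(\<Sum>k<n. d k * q r k * q t k) = (\<Sum>k\<in>{j, m}. d k * q r k * q t k)"
      using j(1) m(1) zero by (intro sum.mono_neutral_right) auto
    then show ?thesis using that \<open>j \<noteq> m\<close> j(2) m(2) by (simp add: decomposition algebra_simps)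
  qed
  have P: "?P \<noteq> 0" using a_eq[of 0 1] off_diagonal_neg[of 0 1] n by auto
  have sign: "q r j = q r m \<or> q r j = - q r m" if "r < n" for r
    using a_eq[OF that that] hollow[OF that] P by (auto simp: square_eq_iff)
  have "\<exists>r t. r < n \<and> t < n \<and> r \<noteq> t \<and> q r j * q t j = q r m * q t m"
    using sign[of 0] sign[of 1] sign[of 2] n
    by (smt (verit) minus_mult_minus one_less_numeral_iff less_trans zero_less_numeral zero_neq_one
        zero_neq_numeral one_eq_numeral_iff semiring_norm(76) num.distinct(1))
  then obtain r t where "r < n" "t < n" "r \<noteq> t" "q r j * q t j = q r m * q t m" by blast
  then have "a r t = 0" by (simp add: a_eq)
  then show False using off_diagonal_neg[of r t] \<open>r < n\<close> \<open>t < n\<close> \<open>r \<noteq> t\<close> by simp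
qed

lemma energy_eq_only_if:
  assumes n: "2 \<le> n" and eq: "energy = 2 * sqrt ((\<Sum>i<n. (neg_row_sum i)\<^sup>2) / real n)"
  shows "\<forall>i<n. \<forall>j<n. neg_row_sum i = neg_row_sum j" and "card {k. k < n \<and> d k < 0} = 1"
proof -
  let ?P = "energy / 2"
  have "?P\<^sup>2 = (\<Sum>i<n. (neg_row_sum i)\<^sup>2) / real n"
    using eq by (simp add: sum_nonneg)
  then have "(\<Sum>i<n. (neg_row_sum i)\<^sup>2) = ?P\<^sup>2 * real n" using n by (simp add: field_simps)
  \<comment> \<open>Equality makes a sum of nonnegative terms vanish, so every eigenvector not
    orthogonal to the all-ones vector has eigenvalue \<open>?P\<close> or
    \<open>- ?P\<close>.\<close>
  then have "(\<Sum>k<n. (?P\<^sup>2 - (d k)\<^sup>2) * (coord k)\<^sup>2) = 0"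
    by (simp add: sum_neg_row_sum_squares left_diff_distrib sum_subtractf sum_coord_squares
        flip: sum_distrib_left)
  moreover have "(d k)\<^sup>2 \<le> ?P\<^sup>2" if "k < n" for k
    using abs_eigenvalue_le[OF that] by (metis abs_ge_zero power2_abs power_mono)
  ultimately have "\<forall>k<n. (?P\<^sup>2 - (d k)\<^sup>2) * (coord k)\<^sup>2 = 0"
    by (subst (asm) sum_nonneg_eq_0_iff) auto
  then have extreme: "d k = ?P \<or> d k = - ?P" if "k < n" "coord k \<noteq> 0" for k
    using that by (auto simp: power2_eq_iff)
  have "0 < (\<Sum>i<n. neg_row_sum i)" using neg_row_sum_pos n by (intro sum_pos) (auto simp: lessThan_empty_iff)
  then have "\<not> (\<forall>k<n. - d k * (coord k)\<^sup>2 \<le> 0)"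
    unfolding sum_neg_row_sum by (meson lessThan_iff not_less sum_nonpos)
  then obtain m where m: "m < n" "0 < - d m * (coord m)\<^sup>2" by (auto simp: not_le)
  then have m_neg: "d m < 0" "coord m \<noteq> 0" by (auto simp: mult_less_0_iff)
  have P: "0 \<le> ?P" by (simp add: sum_nonneg)
  have dm: "d m = - ?P" using extreme[OF m(1) m_neg(2)] m_neg(1) P by auto
  have "\<not> d k < 0" if "k < n" "k \<noteq> m" for k
    using nonneg_of_extreme_neg[OF m(1) dm that] by simp
  then have "{k. k < n \<and> d k < 0} = {m}" using m(1) m_neg(1) by blast
  then show "card {k. k < n \<and> d k < 0} = 1" by simp
  show "\<forall>i<n. \<forall>j<n. neg_row_sum i = neg_row_sum j"
  \<comment> \<open>Either the all-ones vector lies in the eigenspace of \<open>- ?P\<close>, or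
    both extremes occur and the order is 2.\<close>
  proof (cases "\<forall>k<n. coord k \<noteq> 0 \<longrightarrow> d k = - ?P")
    case True
    have "neg_row_sum i = ?P" if "i < n" for i
    proof -
      have "neg_row_sum i = ?P * (\<Sum>k<n. coord k * q i k)"
        unfolding neg_row_sum_expansion[OF that] sum_distrib_left using True by (intro sum.cong) auto
      then show ?thesis using ones_expansion[OF that] by simp
    qed
    then show ?thesis by metis
  next
    case False
    then obtain j where j: "j < n" "d j = ?P" "j \<noteq> m" using extreme dm by blast
    have "n = 2" using extreme_pair_imp_le_2[OF j(1,2) m(1) dm j(3)] n by simp
    \<comment> \<open>In order 2 each row sum is a single off-diagonal entry, and the two entries
      agree by symmetry.\<close>
    moreover have "a 0 1 = a 1 0" using n by (simp add: decomposition mult_ac)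
    ultimately show ?thesis
      unfolding neg_row_sum_def using hollow[of 0] hollow[of 1]
      by (auto simp: less_Suc_eq numeral_2_eq_2)
  qed
qed

end

section \<open>Distance Seidel energy\<close>

lemma distance_seidel_matrix_index:
  assumes "graph G" and "bij_betw v {..<card (verts G)} (verts G)"
    and i: "i < card (verts G)" and j: "j < card (verts G)"
  shows "distance_seidel_matrix G v $$ (i, j)
    = (if i = j then 0 else 1 - 2 * graph_dist G (v i) (v j))"
proof -
  interpret graph G by fact
  have "v i \<in> verts G" using assms(2) i by (auto dest: bij_betwE)
  then show ?thesis
    using i j by (cases "i = j") (simp_all add: distance_seidel_matrix_def distance_matrix_def graph_dist_self)
qed

text \<open>For a single vertex the energy and all degrees are 0, so equality holds without a
  negative eigenvalue; hence the equivalence starts at order 2.\<close>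

theorem theorem5p5:
  fixes G :: "('a, 'b) pre_digraph" and v :: "nat \<Rightarrow> 'a" and n :: nat
  assumes "graph G"
    and "Digraph_Component.connected G"
    and "card (verts G) = n"
    and "bij_betw v {..<n} (verts G)"
  shows "distance_seidel_energy G v \<ge>
           2 * sqrt ((\<Sum>r<n. (distance_seidel_degree G v r)\<^sup>2) / real n) \<and>
         (n \<ge> 2 \<longrightarrow>
           (distance_seidel_energy G v =
              2 * sqrt ((\<Sum>r<n. (distance_seidel_degree G v r)\<^sup>2) / real n) \<longleftrightarrow>
            (\<forall>r<n. \<forall>t<n. distance_seidel_degree G v r = distance_seidel_degree G v t) \<and>
            size {#x \<in># eigenvalues_mset (distance_seidel_matrix G v). x < 0#} = 1))"
proof -
  interpret G: graph G by fact
  let ?S = "distance_seidel_matrix G v"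
  \<comment> \<open>Symmetry of the arcs makes each vertex reachable from each other one, as the
    lower bound on distances requires.\<close>
  have strong: "strongly_connected G"
    using G.symmetric_connected_imp_strongly_connected[OF G.sym_arcs assms(2)] .
  have vert: "v i \<in> verts G" if "i < n" for i using assms(4) that by (auto dest: bij_betwE)
  have inj: "v i \<noteq> v j" if "i < n" "j < n" "i \<noteq> j" for i j
    using assms(4) that by (auto simp: bij_betw_def inj_on_def)
  have dist: "1 \<le> graph_dist G (v i) (v j)" if "i < n" "j < n" "i \<noteq> j" for i j
    using G.graph_dist_ge_1[OF _ inj[OF that]] strong vert that by (auto simp: strongly_connected_def)
  have S: "?S \<in> carrier_mat n n"
    by (simp add: distance_seidel_matrix_def distance_matrix_def assms(3) carrier_matI)
  have S_index: "?S $$ (i, j) = (if i = j then 0 else 1 - 2 * graph_dist G (v i) (v j))"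
    if "i < n" "j < n" for i j
    using distance_seidel_matrix_index[OF assms(1)] assms(3,4) that by simp
  have S_sym: "?S\<^sup>T = ?S"
    using S by (intro eq_matI) (auto simp: S_index G.graph_dist_sym)
  obtain d q where
    eigenvalues: "eigenvalues_mset ?S = image_mset d (mset_set {..<n})" and
    columns: "\<And>i j. i < n \<Longrightarrow> j < n \<Longrightarrow> (\<Sum>k<n. q k i * q k j) = (if i = j then 1 else 0)" and
    rows: "\<And>i j. i < n \<Longrightarrow> j < n \<Longrightarrow> (\<Sum>k<n. q i k * q j k) = (if i = j then 1 else 0)" and
    decomposition: "\<And>i j. i < n \<Longrightarrow> j < n \<Longrightarrow> ?S $$ (i, j) = (\<Sum>k<n. d k * q i k * q j k)"
    by (rule symmetric_matrix_eigenbasis[OF S S_sym]) (rule that; simp)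
  interpret hollow_spectral_decomposition n "\<lambda>i j. ?S $$ (i, j)" q d
  proof
    show "?S $$ (i, j) < 0" if "i < n" "j < n" "i \<noteq> j" for i j
      using dist[OF that] that by (simp add: S_index)
  qed (fact columns rows decomposition | simp add: S_index)+
  have energy: "distance_seidel_energy G v = (\<Sum>k<n. \<bar>d k\<bar>)"
    by (simp add: distance_seidel_energy_def eigenvalues image_mset.compositionality o_def
        sum_unfold_sum_mset)
  have degree: "distance_seidel_degree G v r = neg_row_sum r" if "r < n" for r
  proof -
    have "neg_row_sum r = (\<Sum>t<n. if t = r then 0 else 2 * graph_dist G (v r) (v t) - 1)"
      unfolding neg_row_sum_def using that by (intro sum.cong) (auto simp: S_index)
    also have "\<dots> = (\<Sum>t\<in>{..<n} - {r}. 2 * graph_dist G (v r) (v t) - 1)"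
      using that by (simp add: sum.remove[of _ r])
    finally show ?thesis by (simp add: distance_seidel_degree_def assms(3))
  qed
  \<comment> \<open>Eigenvalues are counted with multiplicity, hence by their indices.\<close>
  have negative: "size {#x \<in># eigenvalues_mset ?S. x < 0#} = card {k. k < n \<and> d k < 0}"
    by (simp add: eigenvalues filter_mset_image_mset filter_mset_mset_set)
  have squares: "(\<Sum>r<n. (distance_seidel_degree G v r)\<^sup>2) = (\<Sum>r<n. (neg_row_sum r)\<^sup>2)"
    by (simp add: degree)
  have constancy: "(\<forall>r<n. \<forall>t<n. distance_seidel_degree G v r = distance_seidel_degree G v t)
      \<longleftrightarrow> (\<forall>r<n. \<forall>t<n. neg_row_sum r = neg_row_sum t)"
    by (simp add: degree)
  show ?thesis
    unfolding energy negative squares constancy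
    using energy_lower_bound energy_eq_if energy_eq_only_if by blast
qed

end
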